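(* Let $\Sigma$ be a finite set, let $p\in\Delta(\Sigma)$ have full support, let $g\in\mathbb{R}^{\Sigma}$, and let $\delta>0$. Let $$q^*\in\arg\max_{q\in\Delta(\Sigma)}\ \Big(g\cdot q-\frac{1}{2\delta}\sum_{u\in\Sigma}\frac{(q_u-p_u)^2}{p_u}\Big).$$ Then there exists $\mu\in\mathbb{R}$ such that $$\forall u\in\Sigma,\qquad q^*_u=p_u\,[1+\delta(g_u+\mu)]_+ ,$$ where $\mu$ is such that $\sum_{u\in\Sigma}q^*_u=1$. In particular, if $\delta\le\dfrac{1}{\max_{u\in\Sigma}g_u-\min_{u\in\Sigma}g_u}$, then $$\forall u\in\Sigma,\qquad q^*_u=p_u\big(1+\delta(g_u-p\cdot g)\big).$$
   Context: $\Delta(\Sigma)$ is the set of probability vectors $q=(q_u)_{u\in\Sigma}$ on the finite set $\Sigma$; full support means $p_u>0$ for all $u$. The dot product is $g\cdot q=\sum_{u\in\Sigma}g_uq_u$. $[x]_+:=\max(0,x)$. If $g$ is constant, the right-hand side of the condition on $\delta$ is read as $+\infty$. *)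

theory Defs
  imports Complex_Main "HOL-Library.Extended_Real"
begin

text \<open>
  A vector indexed by a finite set \<open>S\<close> is represented by a function \<open>'a \<Rightarrow> real\<close>, of which only
  the values on \<open>S\<close> matter; nothing is required of the values outside \<open>S\<close>.
\<close>

definition prob_simplex :: "'a set \<Rightarrow> ('a \<Rightarrow> real) set" where
  "prob_simplex S = {q. (\<forall>u\<in>S. 0 \<le> q u) \<and> (\<Sum>u\<in>S. q u) = 1}"

definition full_support :: "'a set \<Rightarrow> ('a \<Rightarrow> real) \<Rightarrow> bool" where
  "full_support S p \<longleftrightarrow> (\<forall>u\<in>S. 0 < p u)"

definition dot :: "'a set \<Rightarrow> ('a \<Rightarrow> real) \<Rightarrow> ('a \<Rightarrow> real) \<Rightarrow> real" where
  "dot S g q = (\<Sum>u\<in>S. g u * q u)"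

definition pos_part :: "real \<Rightarrow> real" where
  "pos_part x = max 0 x"

definition chi2_objective ::
  "'a set \<Rightarrow> ('a \<Rightarrow> real) \<Rightarrow> ('a \<Rightarrow> real) \<Rightarrow> real \<Rightarrow> ('a \<Rightarrow> real) \<Rightarrow> real" where
  "chi2_objective S p g \<delta> q = dot S g q - 1 / (2 * \<delta>) * (\<Sum>u\<in>S. (q u - p u)\<^sup>2 / p u)"

text \<open>The bound is infinite for constant \<open>g\<close>, where \<open>1 / 0\<close> would be \<open>0\<close> in the reals.\<close>

definition inverse_range :: "'a set \<Rightarrow> ('a \<Rightarrow> real) \<Rightarrow> ereal" where
  "inverse_range S g =
     (if \<forall>u\<in>S. \<forall>v\<in>S. g u = g v then \<infinity> else ereal (1 / (Max (g ` S) - Min (g ` S))))"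

end

theory Submission
  imports Defs
begin

text \<open>
  The objective is strongly concave. Hence a feasible point that satisfies the KKT conditions
  with multiplier \<open>-\<mu>\<close> beats every other feasible point by a positive quadratic term and is
  the unique maximizer. For any \<open>\<mu>\<close> that normalizes it to total mass 1, the truncated
  tilting \<open>p u * [1 + \<delta> * (g u + \<mu>)]\<^sub>+\<close> is such a point. The intermediate value
  theorem provides some \<open>\<mu>\<close>; for small \<open>\<delta>\<close> the value \<open>\<mu> = - p \<cdot> g\<close> works because
  no truncation occurs.
\<close>

text \<open>The left side minus the right side collapses to \<open>(p * (1 + \<delta> * (g + \<mu>))
  - y) * (x - y) / (\<delta> * p)\<close>, which is nonpositive by complementary slackness.\<close>

lemma pos_part_strong_concavity:
  fixes x p g \<delta> \<mu> :: real
  assumes "0 \<le> x" "0 < p" "0 < \<delta>"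
  defines "y \<equiv> p * pos_part (1 + \<delta> * (g + \<mu>))"
  shows "g * x - 1 / (2 * \<delta>) * ((x - p)\<^sup>2 / p) + 1 / (2 * \<delta>) * ((x - y)\<^sup>2 / p)
       \<le> g * y - 1 / (2 * \<delta>) * ((y - p)\<^sup>2 / p) - \<mu> * (x - y)"
proof -
  have sq: "(x - p)\<^sup>2 - (x - y)\<^sup>2 - (y - p)\<^sup>2 = 2 * ((x - y) * (y - p))"
    by (simp add: power2_eq_square algebra_simps)
  have "1 / (2 * \<delta>) * ((x - p)\<^sup>2 / p) - 1 / (2 * \<delta>) * ((x - y)\<^sup>2 / p)
        - 1 / (2 * \<delta>) * ((y - p)\<^sup>2 / p)
      = ((x - p)\<^sup>2 - (x - y)\<^sup>2 - (y - p)\<^sup>2) / (2 * (\<delta> * p))"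
    by (simp add: diff_divide_distrib mult.assoc)
  also have "\<dots> = (x - y) * (y - p) / (\<delta> * p)"
    unfolding sq by (rule mult_divide_mult_cancel_left) simp
  \<comment> \<open>Divided by \<open>\<delta> * p\<close>, the first factor is the derivative at
    \<open>y\<close> of the one-coordinate Lagrangian,
    \<open>g + \<mu> - (y - p) / (\<delta> * p)\<close>.\<close>
  moreover have "(p * (1 + \<delta> * (g + \<mu>)) - y) * (x - y) / (\<delta> * p)
      = (g + \<mu>) * (x - y) - (x - y) * (y - p) / (\<delta> * p)"
    using assms(2,3) by (simp add: divide_simps) (simp add: algebra_simps)
  ultimately have "(g * x - 1 / (2 * \<delta>) * ((x - p)\<^sup>2 / p) + 1 / (2 * \<delta>) * ((x - y)\<^sup>2 / p))
      - (g * y - 1 / (2 * \<delta>) * ((y - p)\<^sup>2 / p) - \<mu> * (x - y))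
      = (p * (1 + \<delta> * (g + \<mu>)) - y) * (x - y) / (\<delta> * p)"
    by (simp add: algebra_simps)
  also have "\<dots> \<le> 0"
  \<comment> \<open>Without truncation the first factor vanishes. With truncation
    \<open>y = 0\<close>, so that factor is negative while \<open>x - y = x\<close> is
    nonnegative.\<close>
  proof (cases "0 \<le> 1 + \<delta> * (g + \<mu>)")
    case True
    then show ?thesis by (simp add: y_def pos_part_def)
  next
    case False
    then have "y = 0" by (simp add: y_def pos_part_def)
    with False assms(1-3) show ?thesis
      by (simp add: divide_nonpos_pos mult_nonpos_nonneg)
  qed
  finally show ?thesis by simp
qed

text \<open>Summing the pointwise inequality cancels the multiplier terms, since \<open>q\<close>
  and the tilted vector both have mass 1. Optimality of \<open>q\<close> then forces the weighted
  squared distance between them to be zero.\<close>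

lemma chi2_argmax_eq_pos_part:
  fixes p g q :: "'a \<Rightarrow> real" and \<delta> \<mu> :: real
  assumes fin: "finite S" and p: "full_support S p" and \<delta>: "0 < \<delta>"
    and max: "is_arg_max (chi2_objective S p g \<delta>) (\<lambda>q. q \<in> prob_simplex S) q"
    and norm: "(\<Sum>u\<in>S. p u * pos_part (1 + \<delta> * (g u + \<mu>))) = 1"
    and u: "u \<in> S"
  shows "q u = p u * pos_part (1 + \<delta> * (g u + \<mu>))"
proof -
  define r where "r u = p u * pos_part (1 + \<delta> * (g u + \<mu>))" for u
  have p_pos: "0 < p v" if "v \<in> S" for v
    using p that by (simp add: full_support_def)
  have q: "q \<in> prob_simplex S"
    using max by (simp add: is_arg_max_def)
  have "r \<in> prob_simplex S"
    using norm p_pos by (auto simp: prob_simplex_def r_def pos_part_def less_imp_le)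
  then have le: "chi2_objective S p g \<delta> r \<le> chi2_objective S p g \<delta> q"
    using max by (auto simp: is_arg_max_def not_less)
  have sum0: "(\<Sum>v\<in>S. \<mu> * (q v - r v)) = 0"
    using q norm by (simp add: prob_simplex_def r_def sum_subtractf flip: sum_distrib_left)
  have "(\<Sum>v\<in>S. g v * q v - 1 / (2 * \<delta>) * ((q v - p v)\<^sup>2 / p v)
                + 1 / (2 * \<delta>) * ((q v - r v)\<^sup>2 / p v))
      \<le> (\<Sum>v\<in>S. g v * r v - 1 / (2 * \<delta>) * ((r v - p v)\<^sup>2 / p v) - \<mu> * (q v - r v))"
    unfolding r_def using q p_pos \<delta>
    by (intro sum_mono pos_part_strong_concavity) (auto simp: prob_simplex_def)
  then have "chi2_objective S p g \<delta> q + 1 / (2 * \<delta>) * (\<Sum>v\<in>S. (q v - r v)\<^sup>2 / p v)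
      \<le> chi2_objective S p g \<delta> r - (\<Sum>v\<in>S. \<mu> * (q v - r v))"
    by (simp only: sum.distrib sum_subtractf sum_distrib_left chi2_objective_def dot_def)
  with le sum0 have "1 / (2 * \<delta>) * (\<Sum>v\<in>S. (q v - r v)\<^sup>2 / p v) \<le> 0"
    by simp
  then have "(\<Sum>v\<in>S. (q v - r v)\<^sup>2 / p v) \<le> 0"
    using \<delta> by (simp add: divide_le_0_iff)
  moreover have nonneg: "0 \<le> (q v - r v)\<^sup>2 / p v" if "v \<in> S" for v
    using p_pos[OF that] by simp
  ultimately have "(\<Sum>v\<in>S. (q v - r v)\<^sup>2 / p v) = 0"
    by (intro antisym sum_nonneg)
  then have "(q u - r u)\<^sup>2 / p u = 0"
    using sum_nonneg_eq_0_iff[OF fin, of "\<lambda>v. (q v - r v)\<^sup>2 / p v"] nonneg u by simp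
  then show ?thesis
    using p_pos[OF u] by (simp add: r_def)
qed

text \<open>At \<open>\<mu> = - Max (g\<close>
  S)\<open>every bracket is at most 1, and at\<close>\<mu> = - Min (g \<open>S)\<close> at least 1.
  As \<open>p\<close> has mass 1, the continuous total mass crosses 1 in between.\<close>

lemma exists_pos_part_normalizer:
  fixes p g :: "'a \<Rightarrow> real" and \<delta> :: real
  assumes fin: "finite S" and p: "p \<in> prob_simplex S" and \<delta>: "0 < \<delta>"
  shows "\<exists>\<mu>. (\<Sum>u\<in>S. p u * pos_part (1 + \<delta> * (g u + \<mu>))) = 1"
proof -
  let ?mass = "\<lambda>\<mu>. \<Sum>u\<in>S. p u * pos_part (1 + \<delta> * (g u + \<mu>))"
  have p_nonneg: "0 \<le> p u" if "u \<in> S" for u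
    using p that by (simp add: prob_simplex_def)
  have sum_p: "sum p S = 1"
    using p by (simp add: prob_simplex_def)
  then have "S \<noteq> {}" by auto
  with fin have g: "Min (g ` S) \<le> g u" "g u \<le> Max (g ` S)" if "u \<in> S" for u
    using that by auto
  have "?mass (- Max (g ` S)) \<le> (\<Sum>u\<in>S. p u * 1)"
    using g \<delta> p_nonneg
    by (intro sum_mono mult_left_mono) (auto simp: pos_part_def mult_le_0_iff)
  moreover have "(\<Sum>u\<in>S. p u * 1) \<le> ?mass (- Min (g ` S))"
    using g \<delta> p_nonneg
    by (intro sum_mono mult_left_mono) (auto simp: pos_part_def le_max_iff_disj)
  moreover have "- Max (g ` S) \<le> - Min (g ` S)"
    using g \<open>S \<noteq> {}\<close> by force
  moreover have "continuous_on {- Max (g ` S)..- Min (g ` S)} ?mass"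
    unfolding pos_part_def by (intro continuous_intros)
  ultimately show ?thesis
    using IVT'[of ?mass "- Max (g ` S)" 1 "- Min (g ` S)"] sum_p by auto
qed

text \<open>The average of \<open>g\<close> under \<open>p\<close> is at most its maximum, so it
  exceeds \<open>g u\<close> by at most the range of \<open>g\<close>, and \<delta> times the range
  is at most 1.\<close>

lemma untruncated_tilt_nonneg:
  fixes p g :: "'a \<Rightarrow> real" and \<delta> :: real
  assumes fin: "finite S" and p: "p \<in> prob_simplex S" and \<delta>: "0 < \<delta>"
    and le: "ereal \<delta> \<le> inverse_range S g" and u: "u \<in> S"
  shows "0 \<le> 1 + \<delta> * (g u - dot S p g)"
proof -
  define M m where "M = Max (g ` S)" and "m = Min (g ` S)"
  have g: "m \<le> g v" "g v \<le> M" if "v \<in> S" for v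
    using fin that by (auto simp: M_def m_def)
  have "dot S p g \<le> (\<Sum>v\<in>S. p v * M)"
    unfolding dot_def using p g by (intro sum_mono mult_left_mono) (auto simp: prob_simplex_def)
  also have "\<dots> = M"
    using p by (simp add: prob_simplex_def flip: sum_distrib_right)
  finally have "dot S p g - g u \<le> M - m"
    using g[OF u] by simp
  then have "\<delta> * (dot S p g - g u) \<le> \<delta> * (M - m)"
    using \<delta> by simp
  also have "\<delta> * (M - m) \<le> 1"
  \<comment> \<open>For constant \<open>g\<close> the bound on \<delta> is infinite and says
    nothing, but the product is 0. Otherwise the finite branch of \<open>inverse_range\<close>
    applies.\<close>
  proof (cases "M = m")
    case False
    then have "m < M" using g[OF u] by simp
    have nonconst: "\<not> (\<forall>v\<in>S. \<forall>w\<in>S. g v = g w)"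
    proof
      assume "\<forall>v\<in>S. \<forall>w\<in>S. g v = g w"
      with u have "g ` S = {g u}" by blast
      with False show False by (simp add: M_def m_def)
    qed
    have "\<delta> \<le> 1 / (M - m)"
      using le unfolding inverse_range_def if_not_P[OF nonconst] by (simp add: M_def m_def)
    with \<open>m < M\<close> show ?thesis
      by (simp add: pos_le_divide_eq)
  qed simp
  finally show ?thesis by (simp add: algebra_simps)
qed

theorem theoremD7:
  fixes \<Sigma> :: "'a set" and p g qstar :: "'a \<Rightarrow> real" and \<delta> :: real
  assumes "finite \<Sigma>"
    and "p \<in> prob_simplex \<Sigma>"
    and "full_support \<Sigma> p"
    and "\<delta> > 0"
    and "is_arg_max (chi2_objective \<Sigma> p g \<delta>) (\<lambda>q. q \<in> prob_simplex \<Sigma>) qstar"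
  shows "(\<exists>\<mu>::real.
            (\<forall>u\<in>\<Sigma>. qstar u = p u * pos_part (1 + \<delta> * (g u + \<mu>)))
          \<and> (\<Sum>u\<in>\<Sigma>. p u * pos_part (1 + \<delta> * (g u + \<mu>))) = 1)
       \<and> (ereal \<delta> \<le> inverse_range \<Sigma> g
          \<longrightarrow> (\<forall>u\<in>\<Sigma>. qstar u = p u * (1 + \<delta> * (g u - dot \<Sigma> p g))))"
proof (intro conjI impI ballI)
  note qstar_eq = chi2_argmax_eq_pos_part[OF assms(1,3,4,5)]
  show "\<exists>\<mu>. (\<forall>u\<in>\<Sigma>. qstar u = p u * pos_part (1 + \<delta> * (g u + \<mu>)))
          \<and> (\<Sum>u\<in>\<Sigma>. p u * pos_part (1 + \<delta> * (g u + \<mu>))) = 1"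
    using exists_pos_part_normalizer[OF assms(1,2,4)] qstar_eq by blast
  fix u
  assume le: "ereal \<delta> \<le> inverse_range \<Sigma> g" and u: "u \<in> \<Sigma>"
  \<comment> \<open>The form \<open>g v + - dot \<Sigma> p g\<close> matches
    \<open>g v + \<mu>\<close> for the candidate multiplier
    \<open>\<mu> = - dot \<Sigma> p g\<close>.\<close>
  have pos_part_eq: "pos_part (1 + \<delta> * (g v + - dot \<Sigma> p g)) = 1 + \<delta> * (g v - dot \<Sigma> p g)"
    if "v \<in> \<Sigma>" for v
    using untruncated_tilt_nonneg[OF assms(1,2,4) le that] by (simp add: pos_part_def)
  have sum_p: "sum p \<Sigma> = 1"
    using assms(2) by (simp add: prob_simplex_def)
  define d where "d = dot \<Sigma> p g"
  \<comment> \<open>Centering \<open>g\<close> at its mean under \<open>p\<close> makes the linear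
    perturbation sum to zero, so the untruncated tilt keeps mass 1.\<close>
  have "(\<Sum>v\<in>\<Sigma>. p v * pos_part (1 + \<delta> * (g v + - dot \<Sigma> p g)))
      = (\<Sum>v\<in>\<Sigma>. p v + \<delta> * (p v * g v) - p v * (\<delta> * d))"
    by (intro sum.cong refl) (simp only: pos_part_eq, simp add: d_def algebra_simps)
  also have "\<dots> = sum p \<Sigma> + \<delta> * d - sum p \<Sigma> * (\<delta> * d)"
    by (simp add: sum.distrib sum_subtractf d_def dot_def flip: sum_distrib_left sum_distrib_right)
  also have "\<dots> = 1"
    by (simp add: sum_p)
  finally show "qstar u = p u * (1 + \<delta> * (g u - dot \<Sigma> p g))"
    using qstar_eq[of "- dot \<Sigma> p g", OF _ u] pos_part_eq[OF u] by simp
qed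

end
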